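(* Let $S=K[t_1,\ldots,t_s]$ be a polynomial ring over a field $K$, let $I$ be a monomial ideal of $S$ with minimal set of monomial generators $\{t^{v_1},\ldots,t^{v_q}\}$, and let $A$ be its incidence matrix, i.e., the $s\times q$ matrix with column vectors $v_1,\ldots,v_q$. The following conditions are equivalent. (a) $I$ is a normal ideal. (b) For each pair of vectors $\alpha\in\mathbb{N}^s$ and $\lambda\in\mathbb{Q}_+^q$ such that $A\lambda\leq\alpha$, there is $m\in\mathbb{N}^q$ satisfying $Am\leq\alpha$ and $|\lambda|=|m|+\epsilon$ with $0\leq\epsilon<1$.
   Context: $\mathbb{N}=\{0,1,2,\ldots\}$ and $\mathbb{Q}_+$ is the set of nonnegative rational numbers. For $a=(a_1,\ldots,a_s)\in\mathbb{N}^s$, $t^a:=t_1^{a_1}\cdots t_s^{a_s}$. For a vector $c=(c_1,\ldots,c_p)$, $|c|:=\sum_{i=1}^p c_i$. Inequalities between vectors are entrywise. An ideal $I$ is called normal if $I^n=\overline{I^n}$ for all $n\geq 1$, where $\overline{I^n}$ is the integral closure of $I^n$ in $S$. *)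

theory Defs
  imports "HOL-Analysis.Analysis" "HOL-Library.Poly_Mapping"
begin

text \<open>
  The polynomial ring \<open>K[t\<^sub>1,\<dots>,t\<^sub>s]\<close> is rendered with variables indexed by a finite type \<open>'s\<close>,
  so \<open>s = CARD('s)\<close>, and exponent vectors in \<open>\<nat>\<^sup>s\<close> of type \<open>nat ^ 's\<close>.
  Addition of exponent vectors is componentwise, hence the product of poly_mapping
  (convolution) is the usual product of polynomials.
\<close>

type_synonym ('s, 'k) mpoly_ring = "(nat ^ 's) \<Rightarrow>\<^sub>0 'k"

definition tvar :: "'s::finite \<Rightarrow> ('s, 'k::comm_ring_1) mpoly_ring" where
  "tvar i = Poly_Mapping.single (axis i 1) 1"

definition tmonom :: "nat ^ 's \<Rightarrow> ('s::finite, 'k::comm_ring_1) mpoly_ring" where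
  "tmonom a = (\<Prod>i\<in>UNIV. tvar i ^ (a $ i))"

lemma tmonom_eq_single:
  "(tmonom a :: ('s::finite, 'k::comm_ring_1) mpoly_ring) = Poly_Mapping.single a 1"
proof -
  have pow: "tvar i ^ n = (Poly_Mapping.single (axis i n) 1 :: ('s, 'k) mpoly_ring)"
    for i :: 's and n :: nat
  proof (induction n)
    case 0
    have "axis i 0 = (0 :: nat ^ 's)" by (simp add: axis_def vec_eq_iff)
    then show ?case by (simp only: power_0 single_one)
  next
    case (Suc n)
    have "axis i 1 + axis i n = (axis i (Suc n) :: nat ^ 's)" by (simp add: axis_def vec_eq_iff)
    then show ?case using Suc by (simp add: tvar_def mult_single)
  qed
  have prod: "(\<Prod>i\<in>X. Poly_Mapping.single (f i) 1) =
      (Poly_Mapping.single (\<Sum>i\<in>X. f i) 1 :: ('s, 'k) mpoly_ring)"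
    if "finite X" for X :: "'s set" and f :: "'s \<Rightarrow> nat ^ 's"
    using that by (induction X rule: finite_induct) (simp_all add: mult_single)
  have "(\<Sum>i\<in>UNIV. axis i (a $ i)) = a"
    by (simp add: vec_eq_iff axis_def if_distrib[of "\<lambda>x. x = _"] sum.delta)
  then show ?thesis by (simp add: tmonom_def pow prod)
qed

text \<open>
  Ideals of a commutative ring are its submodules: \<open>ideal.subspace I\<close> says that \<open>I\<close> is an
  ideal and \<open>ideal.span B\<close> is the ideal generated by \<open>B\<close>.
\<close>

interpretation ideal: module "(*) :: 'a::comm_ring_1 \<Rightarrow> 'a \<Rightarrow> 'a"
  by unfold_locales (simp_all add: algebra_simps)

definition ideal_mult :: "'a::comm_ring_1 set \<Rightarrow> 'a set \<Rightarrow> 'a set" where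
  "ideal_mult I J = ideal.span {x * y | x y. x \<in> I \<and> y \<in> J}"

primrec ideal_power :: "'a::comm_ring_1 set \<Rightarrow> nat \<Rightarrow> 'a set" where
  "ideal_power I 0 = UNIV"
| "ideal_power I (Suc n) = ideal_mult I (ideal_power I n)"

definition integral_over_ideal :: "'a::comm_ring_1 \<Rightarrow> 'a set \<Rightarrow> bool" where
  "integral_over_ideal x I \<longleftrightarrow>
     (\<exists>n\<ge>1. \<exists>c. (\<forall>i\<in>{1..n}. c i \<in> ideal_power I i) \<and>
        x ^ n + (\<Sum>i=1..n. c i * x ^ (n - i)) = 0)"

definition ideal_integral_closure :: "'a::comm_ring_1 set \<Rightarrow> 'a set" where
  "ideal_integral_closure I = {x. integral_over_ideal x I}"

definition normal_ideal :: "'a::comm_ring_1 set \<Rightarrow> bool" where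
  "normal_ideal I \<longleftrightarrow>
     ideal.subspace I \<and> (\<forall>n\<ge>1. ideal_power I n = ideal_integral_closure (ideal_power I n))"

definition monomial_ideal :: "('s::finite, 'k::field) mpoly_ring set \<Rightarrow> bool" where
  "monomial_ideal I \<longleftrightarrow> (\<exists>E. I = ideal.span (tmonom ` E))"

definition minimal_monomial_generators ::
    "('s::finite, 'k::field) mpoly_ring set \<Rightarrow> ('s, 'k) mpoly_ring set \<Rightarrow> bool" where
  "minimal_monomial_generators M I \<longleftrightarrow>
     M \<subseteq> range tmonom \<and> ideal.span M = I \<and> (\<forall>M'. M' \<subset> M \<longrightarrow> ideal.span M' \<noteq> I)"

text \<open>
  The number \<open>q\<close> of generators may be \<open>0\<close> (zero ideal), so columns are indexed by \<open>{..<q}\<close>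
  rather than by a type. Vectors of length \<open>q\<close> are functions on \<open>nat\<close> of which only the
  values below \<open>q\<close> are used.
\<close>

definition incidence_matrix :: "(nat \<Rightarrow> nat ^ 's) \<Rightarrow> 's \<Rightarrow> nat \<Rightarrow> nat" where
  "incidence_matrix v i j = v j $ i"

definition mat_vec_mult ::
    "nat \<Rightarrow> ('s \<Rightarrow> nat \<Rightarrow> nat) \<Rightarrow> (nat \<Rightarrow> 'a::semiring_1) \<Rightarrow> 'a ^ 's" where
  "mat_vec_mult q A x = (\<chi> i. \<Sum>j<q. of_nat (A i j) * x j)"

definition rat_vec :: "nat ^ 's \<Rightarrow> rat ^ 's" where
  "rat_vec a = (\<chi> i. of_nat (a $ i))"

end

theory Submission
  imports Defs
begin

text \<open>
  Everything is read off from exponents. For a set \<open>U\<close> of exponent vectors closed upwards, the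
  polynomials all of whose exponents lie in \<open>U\<close> form an ideal, and \<open>I\<^sup>n\<close> is the ideal obtained from the
  set of \<open>a\<close> with \<open>A m \<le> a\<close> for some \<open>m \<in> \<nat>\<^sup>q\<close> with \<open>|m| = n\<close>
  (\<open>ideal_power_span_monomials\<close>). The integral closure of \<open>I\<^sup>n\<close> is governed in the same way by the
  polyhedron of all \<open>a\<close> with \<open>A \<lambda> \<le> a\<close> for some rational \<open>\<lambda> \<ge> 0\<close> with \<open>|\<lambda>| = n\<close>:

  If \<open>A \<lambda> \<le> \<alpha>\<close> with \<open>|\<lambda>| = n\<close>, then a common denominator \<open>p\<close> of \<open>\<lambda>\<close> gives
  \<open>(t\<^sup>\<alpha>)\<^sup>p \<in> (I\<^sup>n)\<^sup>p\<close>, so \<open>t\<^sup>\<alpha>\<close> is integral over \<open>I\<^sup>n\<close>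
  (\<open>polyhedron_exponent_integral\<close>).

  Conversely, every exponent of a polynomial integral over \<open>I\<^sup>n\<close> lies in the polyhedron
  (\<open>integral_exponent_in_polyhedron\<close>). Otherwise a positive weight separates the exponent from the
  polyhedron. The least weight of an exponent is a monomial valuation, and an integral equation
  cannot hold if the valuation of \<open>f\<close> is smaller than that of \<open>I\<^sup>n\<close>.

  Thus normality says that the integral and the rational description give the same exponents for
  each \<open>n \<ge> 1\<close>, and condition (b) says the same: a given \<open>\<lambda>\<close> can be shrunk until
  \<open>|\<lambda>|\<close> becomes the integer below it.
\<close>

text \<open>
  For the module structure of a commutative ring over itself this rule reads
  \<open>a * (b * x) = (a * b) * x\<close>, which runs against \<open>mult.assoc\<close> in \<open>algebra_simps\<close> and makes
  the simplifier loop.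
\<close>

declare ideal.scale_scale [simp del]

section \<open>Exponents of the powers of a monomial ideal\<close>

definition supported_on :: "(nat ^ 's) set \<Rightarrow> ('s::finite, 'k::field) mpoly_ring set" where
  "supported_on U = {f. Poly_Mapping.keys f \<subseteq> U}"

definition power_exponents :: "nat \<Rightarrow> (nat \<Rightarrow> nat ^ 's) \<Rightarrow> nat \<Rightarrow> (nat ^ 's) set" where
  "power_exponents q v n =
     {a. \<exists>m. (\<Sum>j<q. m j) = n \<and> mat_vec_mult q (incidence_matrix v) m \<le> a}"

lemma mat_vec_mult_nth [simp]:
  "mat_vec_mult q (incidence_matrix v) x $ i = (\<Sum>j<q. of_nat (v j $ i) * x j)"
  by (simp add: mat_vec_mult_def incidence_matrix_def)

lemma power_exponents_upward:
  "a \<in> power_exponents q v n \<Longrightarrow> a \<le> b \<Longrightarrow> b \<in> power_exponents q v n"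
  unfolding power_exponents_def less_eq_vec_def by (blast intro: le_trans)

lemma power_exponents_add:
  assumes "a \<in> power_exponents q v n" "b \<in> power_exponents q v k"
  shows "a + b \<in> power_exponents q v (n + k)"
proof -
  obtain m m' where m: "(\<Sum>j<q. m j) = n" "mat_vec_mult q (incidence_matrix v) m \<le> a"
    and m': "(\<Sum>j<q. m' j) = k" "mat_vec_mult q (incidence_matrix v) m' \<le> b"
    using assms by (auto simp: power_exponents_def)
  have "(\<Sum>j<q. v j $ i * (m j + m' j)) \<le> a $ i + b $ i" for i
    unfolding distrib_left sum.distrib using m(2) m'(2) by (auto simp: less_eq_vec_def intro: add_mono)
  then have "mat_vec_mult q (incidence_matrix v) (\<lambda>j. m j + m' j) \<le> a + b"
    by (simp add: less_eq_vec_def)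
  moreover have "(\<Sum>j<q. m j + m' j) = n + k" using m m' by (simp add: sum.distrib)
  ultimately show ?thesis unfolding power_exponents_def by blast
qed

lemma sum_below:
  fixes m :: "nat \<Rightarrow> nat"
  assumes "n \<le> (\<Sum>j<q. m j)"
  shows "\<exists>m'. (\<forall>j<q. m' j \<le> m j) \<and> (\<Sum>j<q. m' j) = n"
  using assms
proof (induction q arbitrary: n)
  case (Suc q)
  show ?case
  proof (cases "n \<le> (\<Sum>j<q. m j)")
    case True
    then obtain m' where "\<forall>j<q. m' j \<le> m j" "(\<Sum>j<q. m' j) = n" using Suc.IH by blast
    then show ?thesis by (intro exI[of _ "m'(q := 0)"]) (auto simp: less_Suc_eq)
  next
    case False
    with Suc.prems show ?thesis
      by (intro exI[of _ "m(q := n - (\<Sum>j<q. m j))"]) (auto simp: less_Suc_eq)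
  qed
qed auto

text \<open>
  A vector \<open>m\<close> of size \<open>n + k\<close> is the sum of vectors of sizes \<open>n\<close> and \<open>k\<close>; the excess of \<open>a\<close> over
  \<open>A m\<close> goes to the second summand. This makes a monomial of degree \<open>n + k\<close> in the generators a
  product of monomials of degrees \<open>n\<close> and \<open>k\<close>.
\<close>

lemma power_exponents_split:
  assumes "a \<in> power_exponents q v (n + k)"
  shows "\<exists>b c. a = b + c \<and> b \<in> power_exponents q v n \<and> c \<in> power_exponents q v k"
proof -
  obtain m where m: "(\<Sum>j<q. m j) = n + k" "mat_vec_mult q (incidence_matrix v) m \<le> a"
    using assms by (auto simp: power_exponents_def)
  obtain m' where m': "\<forall>j<q. m' j \<le> m j" "(\<Sum>j<q. m' j) = n"
    using sum_below[of n m q] m by auto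
  define b where "b = mat_vec_mult q (incidence_matrix v) m'"
  define m'' where "m'' j = m j - m' j" for j
  have m_eq: "m j = m' j + m'' j" if "j < q" for j
    using m' that by (auto simp: m''_def)
  have "(\<Sum>j<q. m j) = (\<Sum>j<q. m' j) + (\<Sum>j<q. m'' j)"
    by (simp add: sum.distrib[symmetric] m_eq)
  then have sum'': "(\<Sum>j<q. m'' j) = k" using m m' by simp
  have mat: "b $ i + mat_vec_mult q (incidence_matrix v) m'' $ i \<le> a $ i" for i
  proof -
    have "mat_vec_mult q (incidence_matrix v) m $ i =
        b $ i + mat_vec_mult q (incidence_matrix v) m'' $ i"
      by (simp add: b_def sum.distrib[symmetric] m_eq algebra_simps)
    then show ?thesis using m by (metis less_eq_vec_def)
  qed
  have "a = b + (a - b)"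
  proof -
    have "b $ i \<le> a $ i" for i using mat[of i] by linarith
    then show ?thesis by (simp add: vec_eq_iff)
  qed
  moreover have "b \<in> power_exponents q v n"
    unfolding power_exponents_def b_def using m' by (auto simp: less_eq_vec_def)
  moreover have "mat_vec_mult q (incidence_matrix v) m'' \<le> a - b"
    unfolding less_eq_vec_def using mat by (metis add.commute add_le_imp_le_diff vector_minus_component)
  then have "a - b \<in> power_exponents q v k"
    unfolding power_exponents_def using sum'' by blast
  ultimately show ?thesis by blast
qed

lemma power_exponents_0: "power_exponents q v 0 = UNIV"
  by (auto simp: power_exponents_def less_eq_vec_def intro!: exI[of _ "\<lambda>_. 0"])

lemma power_exponents_1: "power_exponents q v 1 = {a. \<exists>j<q. v j \<le> a}"
proof (intro set_eqI iffI; clarsimp)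
  fix a assume "a \<in> power_exponents q v (Suc 0)"
  then obtain m where m: "(\<Sum>j<q. m j) = 1" "mat_vec_mult q (incidence_matrix v) m \<le> a"
    by (auto simp: power_exponents_def)
  then obtain j where j: "j < q" "m j \<ge> 1"
    by (metis One_nat_def Suc_leI bot_nat_0.not_eq_extremum lessThan_iff sum.neutral zero_neq_one)
  have "v j $ i \<le> a $ i" for i
  proof -
    have "v j $ i \<le> v j $ i * m j" using j by simp
    also have "\<dots> \<le> (\<Sum>j<q. v j $ i * m j)" using j by (intro member_le_sum) auto
    also have "\<dots> \<le> a $ i" using m by (simp add: less_eq_vec_def)
    finally show ?thesis .
  qed
  then show "\<exists>j<q. v j \<le> a" using j by (auto simp: less_eq_vec_def)
next
  fix a j assume j: "j < q" "v j \<le> a"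
  then show "a \<in> power_exponents q v (Suc 0)"
    unfolding power_exponents_def
    by (auto simp: less_eq_vec_def if_distrib cong: if_cong
        intro!: exI[of _ "\<lambda>l. if l = j then 1 else 0"])
qed

section \<open>Monomial ideals as sets of exponents\<close>

lemma sum_single_keys:
  fixes f :: "'a \<Rightarrow>\<^sub>0 'b::comm_monoid_add"
  shows "(\<Sum>a\<in>Poly_Mapping.keys f. Poly_Mapping.single a (Poly_Mapping.lookup f a)) = f"
proof (rule poly_mapping_eqI)
  fix k
  show "Poly_Mapping.lookup (\<Sum>a\<in>Poly_Mapping.keys f. Poly_Mapping.single a (Poly_Mapping.lookup f a)) k
      = Poly_Mapping.lookup f k"
    by (auto simp: lookup_sum lookup_single when_def sum.delta in_keys_iff)
qed

lemma subspace_supported_on: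
  assumes "\<And>a b. a \<in> U \<Longrightarrow> a \<le> b \<Longrightarrow> b \<in> U"
  shows "ideal.subspace (supported_on U)"
proof (rule ideal.subspaceI)
  show "0 \<in> supported_on U" by (simp add: supported_on_def)
  show "x + y \<in> supported_on U" if "x \<in> supported_on U" "y \<in> supported_on U" for x y
    using that keys_add[of x y] by (auto simp: supported_on_def)
  show "c * x \<in> supported_on U" if "x \<in> supported_on U" for c x
    using that keys_mult[of c x] assms
    by (fastforce simp: supported_on_def less_eq_vec_def)
qed

text \<open>
  A monomial ideal contains a polynomial as soon as it contains each of its terms, and a term lies
  in it when one of the generating monomials divides it.
\<close>

lemma span_monomials:
  "ideal.span (tmonom ` E) = supported_on {a. \<exists>e\<in>E. e \<le> a}" (is "_ = supported_on ?U")
proof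
  show "ideal.span (tmonom ` E) \<subseteq> supported_on ?U"
    by (rule ideal.span_minimal)
      (auto simp: supported_on_def tmonom_eq_single less_eq_vec_def
        intro!: subspace_supported_on[unfolded supported_on_def less_eq_vec_def] intro: le_trans)
  show "supported_on ?U \<subseteq> ideal.span (tmonom ` E)"
  proof
    fix f assume f: "f \<in> supported_on ?U"
    have "(\<Sum>a\<in>Poly_Mapping.keys f. Poly_Mapping.single a (Poly_Mapping.lookup f a))
        \<in> ideal.span (tmonom ` E)"
    proof (rule ideal.span_sum)
      fix a assume "a \<in> Poly_Mapping.keys f"
      then obtain e where e: "e \<in> E" "e \<le> a" using f by (auto simp: supported_on_def)
      then have "a - e + e = a" by (simp add: vec_eq_iff less_eq_vec_def)
      then have "Poly_Mapping.single a (Poly_Mapping.lookup f a) =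
          Poly_Mapping.single (a - e) (Poly_Mapping.lookup f a) * tmonom e"
        by (simp add: tmonom_eq_single mult_single)
      then show "Poly_Mapping.single a (Poly_Mapping.lookup f a) \<in> ideal.span (tmonom ` E)"
        using e by (simp add: ideal.span_base ideal.span_scale)
    qed
    then show "f \<in> ideal.span (tmonom ` E)" by (simp add: sum_single_keys)
  qed
qed

lemma subspace_power_exponents: "ideal.subspace (supported_on (power_exponents q v n))"
  by (rule subspace_supported_on) (rule power_exponents_upward)

text \<open>
  The exponents of a product are sums of exponents of the factors; conversely each term with
  exponent \<open>a = b + c\<close> is itself a product of terms with exponents \<open>b\<close> and \<open>c\<close>, so that the sets of
  exponents add exactly as the ideals multiply.
\<close>

lemma ideal_mult_power_exponents:
  "ideal_mult (supported_on (power_exponents q v n)) (supported_on (power_exponents q v k)) =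
   (supported_on (power_exponents q v (n + k)) :: ('s::finite, 'k::field) mpoly_ring set)"
  (is "ideal_mult ?N ?K = ?S")
proof
  show "ideal_mult ?N ?K \<subseteq> ?S"
    unfolding ideal_mult_def
  proof (rule ideal.span_minimal[OF _ subspace_power_exponents], clarify)
    fix x y :: "('s, 'k) mpoly_ring" assume "x \<in> ?N" "y \<in> ?K"
    then show "x * y \<in> ?S"
      using keys_mult[of x y] power_exponents_add unfolding supported_on_def by blast
  qed
  show "?S \<subseteq> ideal_mult ?N ?K"
  proof
    fix f :: "('s, 'k) mpoly_ring" assume f: "f \<in> ?S"
    have "(\<Sum>a\<in>Poly_Mapping.keys f. Poly_Mapping.single a (Poly_Mapping.lookup f a))
        \<in> ideal_mult ?N ?K"
      unfolding ideal_mult_def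
    proof (rule ideal.span_sum)
      fix a assume "a \<in> Poly_Mapping.keys f"
      then obtain b c where bc: "a = b + c" "b \<in> power_exponents q v n" "c \<in> power_exponents q v k"
        using f power_exponents_split[of a q v n k] by (auto simp: supported_on_def)
      then have "Poly_Mapping.single a (Poly_Mapping.lookup f a) =
          Poly_Mapping.single b (Poly_Mapping.lookup f a) * Poly_Mapping.single c 1"
        by (simp add: mult_single)
      moreover have "Poly_Mapping.single b (Poly_Mapping.lookup f a) \<in> ?N"
        "Poly_Mapping.single c 1 \<in> ?K"
        using bc by (auto simp: supported_on_def)
      ultimately show "Poly_Mapping.single a (Poly_Mapping.lookup f a)
          \<in> ideal.span {x * y |x y. x \<in> ?N \<and> y \<in> ?K}"
        by (intro ideal.span_base) blast
    qed
    then show "f \<in> ideal_mult ?N ?K" by (simp add: sum_single_keys)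
  qed
qed

lemma ideal_power_power_exponents:
  "ideal_power (supported_on (power_exponents q v n)) k = supported_on (power_exponents q v (n * k))"
proof (induction k)
  case 0
  show ?case by (simp add: power_exponents_0 supported_on_def)
next
  case (Suc k)
  then show ?case by (simp add: ideal_mult_power_exponents)
qed

lemma ideal_power_span_monomials:
  "ideal_power (ideal.span ((\<lambda>j. tmonom (v j)) ` {..<q})) n =
   (supported_on (power_exponents q v n) :: ('s::finite, 'k::field) mpoly_ring set)"
proof -
  have "ideal.span ((\<lambda>j. tmonom (v j)) ` {..<q}) =
      (supported_on (power_exponents q v 1) :: ('s, 'k) mpoly_ring set)"
    using span_monomials[of "v ` {..<q}"]
    unfolding power_exponents_1 by (simp add: image_image Bex_def)
  then show ?thesis by (simp only: ideal_power_power_exponents mult_1)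
qed

section \<open>Integrality from a power\<close>

lemma power_tmonom: "tmonom a ^ p = tmonom (\<chi> i. p * a $ i)"
  by (simp add: tmonom_def prod_power_distrib power_mult[symmetric] mult.commute)

lemma integral_over_self:
  assumes "ideal.subspace J" "x \<in> J"
  shows "integral_over_ideal x J"
proof -
  have "- x * 1 \<in> ideal_mult J UNIV"
    unfolding ideal_mult_def using ideal.subspace_neg[OF assms]
    by (intro ideal.span_base) blast
  then show ?thesis unfolding integral_over_ideal_def
    by (intro exI[of _ 1] conjI exI[of _ "\<lambda>_. - x"]) auto
qed

text \<open>
  The integral equation is \<open>X\<^sup>p - x\<^sup>p = 0\<close>, whose only coefficient is in degree \<open>p\<close>.
\<close>

lemma integral_over_ideal_if_power:
  assumes "p \<ge> 1" and J: "\<And>i. ideal.subspace (ideal_power J i)" and "x ^ p \<in> ideal_power J p"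
  shows "integral_over_ideal x J"
proof -
  define c where "c i = (if i = p then - (x ^ p) else 0)" for i
  have "- (x ^ p) \<in> ideal_power J p" using assms by (simp add: ideal.subspace_neg)
  then have "c i \<in> ideal_power J i" if "i \<in> {1..p}" for i
    using J by (auto simp: c_def ideal.subspace_0)
  moreover have "(\<Sum>i=1..p. c i * x ^ (p - i)) = - (x ^ p)"
  proof -
    have "(\<Sum>i=1..p. c i * x ^ (p - i)) = (\<Sum>i=1..p. if i = p then - (x ^ p) else 0)"
      by (intro sum.cong) (auto simp: c_def)
    then show ?thesis using assms(1) by simp
  qed
  ultimately show ?thesis unfolding integral_over_ideal_def using assms(1)
    by (intro exI[of _ p] conjI exI[of _ c]) auto
qed

section \<open>A theorem of the alternative\<close>

lemma finite_sets_strictly_separated: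
  fixes L U :: "'a::linordered_field set"
  assumes "finite L" "finite U" "\<And>l u. l \<in> L \<Longrightarrow> u \<in> U \<Longrightarrow> l < u"
  shows "\<exists>t. (\<forall>l\<in>L. l < t) \<and> (\<forall>u\<in>U. t < u)"
proof (cases "L = {} \<or> U = {}")
  case True
  obtain b b' where "b < Min U" "Max L < b'" using lt_ex gt_ex by blast
  then have "\<forall>u\<in>U. b < u" "\<forall>l\<in>L. l < b'"
    using Min_le[OF assms(2)] Max_ge[OF assms(1)] by (meson less_le_trans le_less_trans)+
  then show ?thesis using True by blast
next
  case False
  then have "Max L < Min U" using assms by simp
  then obtain t where "Max L < t" "t < Min U" using dense by blast
  then show ?thesis using assms(1,2) False by auto
qed

text \<open>
  Ville's theorem of the alternative: either some nonnegative nonzero combination of the vectors in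
  \<open>D\<close> is nonpositive on \<open>X\<close>, or a positive weight is positive on all of \<open>D\<close>. The combinations are
  represented by any convex cone \<open>C\<close> that contains \<open>D\<close>; this keeps the coefficients out of the
  induction and works over every ordered field, so that rational data give rational coefficients.

  The proof is Fourier-Motzkin elimination of the coordinates of \<open>X\<close> one at a time. To eliminate
  \<open>k\<close>, each pair of vectors with opposite signs at \<open>k\<close> is replaced by the positive combination that
  vanishes at \<open>k\<close>, and the cone is cut down to the vectors that are nonpositive at \<open>k\<close>. A weight
  for the remaining coordinates leaves for \<open>w k\<close> an open interval, bounded below by \<open>0\<close> and by the
  vectors that are positive at \<open>k\<close>, and above by those that are negative at \<open>k\<close>. It is nonempty
  because the weight is positive on the vectors that are negative at \<open>k\<close> and on the combined pairs.
\<close>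

lemma ville_alternative:
  fixes C D :: "('i \<Rightarrow> 'a::linordered_field) set"
  assumes "finite X" "finite D" "D \<subseteq> C"
    and "\<And>x y. x \<in> C \<Longrightarrow> y \<in> C \<Longrightarrow> (\<lambda>i. x i + y i) \<in> C"
    and "\<And>c x. 0 < c \<Longrightarrow> x \<in> C \<Longrightarrow> (\<lambda>i. c * x i) \<in> C"
  shows "(\<exists>d\<in>C. \<forall>i\<in>X. d i \<le> 0) \<or>
    (\<exists>w. (\<forall>i\<in>X. 0 < w i) \<and> (\<forall>d\<in>D. 0 < (\<Sum>i\<in>X. w i * d i)))"
  using assms
proof (induction X arbitrary: C D rule: finite_induct)
  case empty
  then show ?case by (cases "D = {}") auto
next
  case (insert k X)
  define P where "P = {d \<in> D. 0 < d k}"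
  define N where "N = {d \<in> D. d k < 0}"
  \<comment> \<open>The images of the pairs vanish at \<open>k\<close>, as \<open>- n k\<close> and \<open>p k\<close> are positive.\<close>
  define D' where "D' = {d \<in> D. d k \<le> 0} \<union> (\<lambda>(p, n) i. - n k * p i + p k * n i) ` (P \<times> N)"
  define C' where "C' = {d \<in> C. d k \<le> 0}"
  have fin: "finite P" "finite N" using insert.prems(1) by (auto simp: P_def N_def)
  have "finite D'" using insert.prems(1) fin by (auto simp: D'_def)
  moreover have "D' \<subseteq> C'"
  proof -
    have "(\<lambda>i. - n k * p i + p k * n i) \<in> C'" if "p \<in> P" "n \<in> N" for p n
    proof -
      have "(\<lambda>i. (- n k) * p i) \<in> C" "(\<lambda>i. p k * n i) \<in> C"
        using that insert.prems(2) insert.prems(4)[of "- n k" p] insert.prems(4)[of "p k" n]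
        by (auto simp: P_def N_def)
      then show ?thesis using insert.prems(3) by (fastforce simp: C'_def)
    qed
    then show ?thesis using insert.prems(2) by (auto simp: D'_def C'_def)
  qed
  moreover have "(\<lambda>i. x i + y i) \<in> C'" if "x \<in> C'" "y \<in> C'" for x y
    using that insert.prems(3) by (auto simp: C'_def intro: add_nonpos_nonpos)
  moreover have "(\<lambda>i. c * x i) \<in> C'" if "0 < c" "x \<in> C'" for c x
    using that insert.prems(4) by (auto simp: C'_def mult_le_0_iff)
  ultimately consider
      d where "d \<in> C'" "\<forall>i\<in>X. d i \<le> 0"
    | w where "\<forall>i\<in>X. 0 < w i" "\<forall>d\<in>D'. 0 < (\<Sum>i\<in>X. w i * d i)"
    using insert.IH[of D' C'] by blast
  then show ?case
  proof cases
    case 1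
    then show ?thesis unfolding C'_def by blast
  next
    case 2
    define s where "s d = (\<Sum>i\<in>X. w i * d i)" for d
    have s_nonpos: "0 < s d" if "d \<in> D" "d k \<le> 0" for d
    proof -
      have "d \<in> D'" unfolding D'_def using that by blast
      then show ?thesis using 2(2) by (simp add: s_def)
    qed
    have s_mixed: "0 < - n k * s p + p k * s n" if "p \<in> P" "n \<in> N" for p n
    proof -
      have "s (\<lambda>i. - n k * p i + p k * n i) = - n k * s p + p k * s n"
      proof -
        have "w i * (- n k * p i + p k * n i) = - n k * (w i * p i) + p k * (w i * n i)" for i
          by (simp only: distrib_left mult.left_commute)
        then show ?thesis by (simp only: s_def sum.distrib sum_distrib_left)
      qed
      moreover have "(\<lambda>i. - n k * p i + p k * n i) \<in> D'"
        unfolding D'_def using that by (intro UnI2 image_eqI[of _ _ "(p, n)"]) auto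
      then have "0 < s (\<lambda>i. - n k * p i + p k * n i)" using 2(2) by (simp add: s_def)
      ultimately show ?thesis by simp
    qed
    have "\<exists>t. (\<forall>l\<in>insert 0 ((\<lambda>p. - s p / p k) ` P). l < t) \<and> (\<forall>u\<in>(\<lambda>n. s n / - n k) ` N. t < u)"
    proof (rule finite_sets_strictly_separated)
      fix l u assume "l \<in> insert 0 ((\<lambda>p. - s p / p k) ` P)" "u \<in> (\<lambda>n. s n / - n k) ` N"
      then obtain n where n: "n \<in> N" "u = s n / - n k"
        and l: "l = 0 \<or> (\<exists>p\<in>P. l = - s p / p k)" by blast
      have nk: "n k < 0" "0 < s n" using n s_nonpos by (auto simp: N_def)
      then have "0 < u" unfolding n by (intro divide_pos_pos) auto
      moreover have "- s p / p k < u" if "p \<in> P" for p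
      proof -
        have pk: "0 < p k" and nk': "0 < - n k" using that nk by (simp_all add: P_def)
        have "- s p * - n k < s n * p k"
          using s_mixed[OF that n(1)] by (simp add: mult.commute)
        then show ?thesis
          unfolding n(2) by (simp only: pos_divide_less_eq[OF pk] times_divide_eq_left pos_less_divide_eq[OF nk'])
      qed
      ultimately show "l < u" using l by auto
    qed (use fin in auto)
    then obtain t where t: "0 < t" "\<And>p. p \<in> P \<Longrightarrow> - s p / p k < t"
      "\<And>n. n \<in> N \<Longrightarrow> t < s n / - n k" by auto
    have pos: "0 < t * d k + s d" if d: "d \<in> D" for d
    proof -
      consider "d \<in> P" | "d \<in> N" | "d k = 0"
        using d less_linear[of "d k" 0] unfolding P_def N_def by blast
      then show ?thesis
      proof cases
        case 1
        then have "0 < d k" by (simp add: P_def)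
        then have "- s d < t * d k" using t(2)[OF 1] by (simp only: pos_divide_less_eq)
        then show ?thesis by simp
      next
        case 2
        then have "0 < - d k" by (simp add: N_def)
        then have "t * (- d k) < s d" using t(3)[OF 2] by (simp only: pos_less_divide_eq)
        then show ?thesis by simp
      next
        case 3
        then show ?thesis using s_nonpos d by simp
      qed
    qed
    have sum_upd: "(\<Sum>i\<in>insert k X. (w(k := t)) i * d i) = t * d k + s d" for d
    proof -
      have "(\<Sum>i\<in>X. (w(k := t)) i * d i) = s d"
        unfolding s_def using insert.hyps by (intro sum.cong) auto
      then show ?thesis by (simp only: sum.insert[OF insert.hyps] fun_upd_same)
    qed
    show ?thesis
    proof (rule disjI2, rule exI, rule conjI)
      show "\<forall>i\<in>insert k X. 0 < (w(k := t)) i" using 2(1) t(1) by simp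
      show "\<forall>d\<in>D. 0 < (\<Sum>i\<in>insert k X. (w(k := t)) i * d i)"
      proof
        fix d assume "d \<in> D"
        then have "0 < t * d k + s d" by (rule pos)
        then show "0 < (\<Sum>i\<in>insert k X. (w(k := t)) i * d i)" by (simp only: sum_upd[of d])
      qed
    qed
  qed
qed

section \<open>Generic weights and the least exponent\<close>

definition weight :: "real ^ 's \<Rightarrow> nat ^ 's::finite \<Rightarrow> real" where
  "weight w a = (\<Sum>i\<in>UNIV. w $ i * real (a $ i))"

lemma weight_add: "weight w (a + b) = weight w a + weight w b"
  by (simp add: weight_def sum.distrib algebra_simps)

lemma weight_mono: "(\<And>i. 0 \<le> w $ i) \<Longrightarrow> a \<le> b \<Longrightarrow> weight w a \<le> weight w b"
  by (auto simp: weight_def less_eq_vec_def intro!: sum_mono mult_left_mono)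

lemma weight_mat_vec_mult:
  "weight w (mat_vec_mult q (incidence_matrix v) m) = (\<Sum>j<q. real (m j) * weight w (v j))"
proof -
  have "weight w (mat_vec_mult q (incidence_matrix v) m) =
      (\<Sum>i\<in>UNIV. \<Sum>j<q. w $ i * (real (v j $ i) * real (m j)))"
    by (simp add: weight_def sum_distrib_left)
  also have "\<dots> = (\<Sum>j<q. \<Sum>i\<in>UNIV. w $ i * (real (v j $ i) * real (m j)))"
    by (rule sum.swap)
  finally show ?thesis by (simp add: weight_def sum_distrib_left algebra_simps)
qed

text \<open>
  A weight fails to separate the exponent vectors only if it is orthogonal to one of the countably
  many differences of two of them, and countably many hyperplanes do not cover an open set.
\<close>

lemma generic_weight:
  fixes G :: "(real ^ 's) set"
  assumes "open G" "G \<noteq> {}"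
  shows "\<exists>w\<in>G. inj (weight w)"
proof -
  let ?r = "\<lambda>a. (\<chi> i. real (a $ i)) :: real ^ 's"
  let ?B = "\<Union>(a, b)\<in>{(a, b). a \<noteq> b}. {w. (?r a - ?r b) \<bullet> w = 0}"
  have "negligible ?B"
  proof (rule negligible_countable_Union)
    show "countable ((\<lambda>(a, b). {w. (?r a - ?r b) \<bullet> w = 0}) ` {(a, b). a \<noteq> b})" by auto
    fix S assume "S \<in> (\<lambda>(a, b). {w. (?r a - ?r b) \<bullet> w = 0}) ` {(a, b). a \<noteq> b}"
    then obtain a b where ab: "a \<noteq> b" "S = {w. (?r a - ?r b) \<bullet> w = 0}" by blast
    then have "?r a - ?r b \<noteq> 0" by (auto simp: vec_eq_iff)
    then show "negligible S" unfolding ab(2) by (intro negligible_hyperplane) auto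
  qed
  then have "\<not> G \<subseteq> ?B" using assms open_not_negligible negligible_subset by blast
  then obtain w where w: "w \<in> G" "w \<notin> ?B" by blast
  have "(?r a - ?r b) \<bullet> w = weight w a - weight w b" for a b
    by (simp add: weight_def inner_vec_def sum_subtractf[symmetric] algebra_simps)
  then have "weight w a = weight w b \<longrightarrow> a = b" for a b using w(2) by auto
  then show ?thesis using w(1) by (auto simp: inj_def)
qed

text \<open>
  Among the pairs of exponents of \<open>f\<close> and \<open>g\<close> with sum \<open>a + b\<close> only the pair \<open>(a, b)\<close> has both weights
  minimal, so nothing can cancel its contribution to the product. Injectivity of \<open>h\<close> is what makes
  the least exponent unique.
\<close>

lemma lookup_mult_least:
  fixes h :: "'a::comm_monoid_add \<Rightarrow> real" and f g :: "'a \<Rightarrow>\<^sub>0 'k::comm_ring_1"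
  assumes add: "\<And>a b. h (a + b) = h a + h b" and "inj h"
    and f: "\<And>x. x \<in> Poly_Mapping.keys f \<Longrightarrow> h a \<le> h x"
    and g: "\<And>x. x \<in> Poly_Mapping.keys g \<Longrightarrow> h b \<le> h x"
  shows "Poly_Mapping.lookup (f * g) (a + b) = Poly_Mapping.lookup f a * Poly_Mapping.lookup g b"
proof -
  define f' where "f' = f - Poly_Mapping.single a (Poly_Mapping.lookup f a)"
  define g' where "g' = g - Poly_Mapping.single b (Poly_Mapping.lookup g b)"
  have f': "h a < h x" if "x \<in> Poly_Mapping.keys f'" for x
  proof -
    have "x \<noteq> a" "x \<in> Poly_Mapping.keys f"
      using that by (auto simp: f'_def in_keys_iff lookup_minus lookup_single when_def split: if_splits)
    then show ?thesis using f[of x] \<open>inj h\<close> by (metis injD order_le_less)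
  qed
  have g': "h b < h x" if "x \<in> Poly_Mapping.keys g'" for x
  proof -
    have "x \<noteq> b" "x \<in> Poly_Mapping.keys g"
      using that by (auto simp: g'_def in_keys_iff lookup_minus lookup_single when_def split: if_splits)
    then show ?thesis using g[of x] \<open>inj h\<close> by (metis injD order_le_less)
  qed
  have not_key1: "Poly_Mapping.lookup (f' * g) (a + b) = 0"
  proof (rule ccontr)
    assume "Poly_Mapping.lookup (f' * g) (a + b) \<noteq> 0"
    then obtain x y where "a + b = x + y" "x \<in> Poly_Mapping.keys f'" "y \<in> Poly_Mapping.keys g"
      using keys_mult[of f' g] by (auto simp: in_keys_iff[symmetric])
    then show False using f'[of x] g[of y] add[of a b] add[of x y] by simp
  qed
  have not_key2: "Poly_Mapping.lookup (Poly_Mapping.single a c * g') (a + b) = 0" for c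
  proof (rule ccontr)
    assume "Poly_Mapping.lookup (Poly_Mapping.single a c * g') (a + b) \<noteq> 0"
    then obtain x y where "a + b = x + y" "x \<in> Poly_Mapping.keys (Poly_Mapping.single a c)"
      "y \<in> Poly_Mapping.keys g'"
      using keys_mult[of "Poly_Mapping.single a c" g'] by (auto simp: in_keys_iff[symmetric])
    then show False using g'[of y] add[of a b] add[of x y] by (auto split: if_splits)
  qed
  have "f * g = f' * g + Poly_Mapping.single a (Poly_Mapping.lookup f a) * g'
      + Poly_Mapping.single (a + b) (Poly_Mapping.lookup f a * Poly_Mapping.lookup g b)"
    by (simp add: f'_def g'_def mult_single[symmetric] algebra_simps)
  then show ?thesis by (simp add: lookup_add not_key1 not_key2)
qed

text \<open>
  The least weight of an exponent behaves like a valuation on powers: the power of the least term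
  survives.
\<close>

lemma power_least_weight:
  fixes h :: "'a::comm_monoid_add \<Rightarrow> real" and f :: "'a \<Rightarrow>\<^sub>0 'k::idom"
  assumes add: "\<And>a b. h (a + b) = h a + h b" and "inj h"
    and b: "b \<in> Poly_Mapping.keys f" "\<And>x. x \<in> Poly_Mapping.keys f \<Longrightarrow> h b \<le> h x"
  shows "(\<exists>y\<in>Poly_Mapping.keys (f ^ n). h y = real n * h b) \<and>
    (\<forall>x\<in>Poly_Mapping.keys (f ^ n). real n * h b \<le> h x)"
proof (induction n)
  case 0
  have "h 0 = 0" using add[of 0 0] by simp
  then show ?case by simp
next
  case (Suc n)
  then obtain y where y: "y \<in> Poly_Mapping.keys (f ^ n)" "h y = real n * h b"
    and le: "\<And>x. x \<in> Poly_Mapping.keys (f ^ n) \<Longrightarrow> h y \<le> h x" by auto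
  have "Poly_Mapping.lookup (f * f ^ n) (b + y) \<noteq> 0"
    using lookup_mult_least[of h f b "f ^ n" y, OF add \<open>inj h\<close> b(2) le] b(1) y(1)
    by (simp add: in_keys_iff)
  then have "b + y \<in> Poly_Mapping.keys (f ^ Suc n)" by (simp add: in_keys_iff)
  moreover have "h (b + y) = real (Suc n) * h b" by (simp add: add y algebra_simps)
  moreover have "real (Suc n) * h b \<le> h x" if x: "x \<in> Poly_Mapping.keys (f ^ Suc n)" for x
  proof -
    obtain c z where "x = c + z" "c \<in> Poly_Mapping.keys f" "z \<in> Poly_Mapping.keys (f ^ n)"
      using x keys_mult[of f "f ^ n"] by auto
    then show ?thesis using b(2)[of c] le[of z] y(2) by (simp add: add algebra_simps)
  qed
  ultimately show ?case by blast
qed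

section \<open>The integral closure and the rational polyhedron\<close>

text \<open>
  Ville's theorem is applied to the vectors \<open>d j = n v\<^sub>j - \<alpha>\<close>. A nonnegative combination of them
  that is nonpositive yields, after scaling the coefficients to have sum \<open>n\<close>, the required \<open>\<lambda>\<close>.

  Otherwise some positive weight, which may be taken generic because the conditions on it are open,
  has \<open>weight \<alpha> < n weight v\<^sub>j\<close> for all \<open>j\<close>. Then for \<open>i \<ge> 1\<close> every exponent of \<open>(I\<^sup>n)\<^sup>i\<close> has weight
  larger than \<open>i weight \<alpha>\<close>. Let \<open>b\<close> be the exponent of \<open>f\<close> of least weight. The power \<open>f\<^sup>N\<close> has an exponent
  of weight \<open>N weight b\<close>, while all exponents of the terms \<open>c\<^sub>i f\<^sup>N\<^sup>-\<^sup>i\<close> of the integral equation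
  have larger weight.
\<close>

lemma integral_exponent_in_polyhedron:
  fixes f :: "('s::finite, 'k::field) mpoly_ring"
  assumes int: "integral_over_ideal f (supported_on (power_exponents q v n))"
    and \<alpha>: "\<alpha> \<in> Poly_Mapping.keys f"
    and n: "n \<ge> 1"
  shows "\<exists>lam :: nat \<Rightarrow> rat. (\<forall>j<q. 0 \<le> lam j) \<and> (\<Sum>j<q. lam j) = of_nat n \<and>
    mat_vec_mult q (incidence_matrix v) lam \<le> rat_vec \<alpha>"
proof -
  define d where "d j i = of_nat n * of_nat (v j $ i) - (of_nat (\<alpha> $ i) :: rat)" for j i
  define C where "C = {x. \<exists>lam :: nat \<Rightarrow> rat. (\<forall>j<q. 0 \<le> lam j) \<and> 0 < (\<Sum>j<q. lam j) \<and>
     x = (\<lambda>i. \<Sum>j<q. lam j * d j i)}"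
  have "(\<exists>x\<in>C. \<forall>i\<in>UNIV. x i \<le> 0) \<or>
    (\<exists>w. (\<forall>i\<in>UNIV. 0 < w i) \<and> (\<forall>x\<in>d ` {..<q}. 0 < (\<Sum>i\<in>UNIV. w i * x i)))"
  proof (rule ville_alternative)
    show "d ` {..<q} \<subseteq> C"
    proof clarify
      fix j assume "j < q"
      then show "d j \<in> C" unfolding C_def
        by (auto intro!: exI[of _ "\<lambda>l. if l = j then 1 else 0"] simp: if_distrib[of "\<lambda>x. x * _"] cong: if_cong)
    qed
    fix x y assume "x \<in> C" "y \<in> C"
    then obtain l l' where "(\<forall>j<q. 0 \<le> l j)" "0 < (\<Sum>j<q. l j)" "x = (\<lambda>i. \<Sum>j<q. l j * d j i)"
      "(\<forall>j<q. 0 \<le> l' j)" "0 < (\<Sum>j<q. l' j)" "y = (\<lambda>i. \<Sum>j<q. l' j * d j i)"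
      unfolding C_def by blast
    then show "(\<lambda>i. x i + y i) \<in> C" unfolding C_def
      by (auto intro!: exI[of _ "\<lambda>j. l j + l' j"] simp: sum.distrib algebra_simps)
  next
    fix c :: rat and x assume c: "0 < c" and "x \<in> C"
    then obtain l where "(\<forall>j<q. 0 \<le> l j)" "0 < (\<Sum>j<q. l j)" "x = (\<lambda>i. \<Sum>j<q. l j * d j i)"
      unfolding C_def by blast
    with c show "(\<lambda>i. c * x i) \<in> C" unfolding C_def
      by (auto intro!: exI[of _ "\<lambda>j. c * l j"] simp: sum_distrib_left[symmetric] mult.assoc)
  qed auto
  then consider
      x where "x \<in> C" "\<And>i. x i \<le> 0"
    | w where "\<And>i. 0 < w i" "\<And>j. j < q \<Longrightarrow> 0 < (\<Sum>i\<in>UNIV. w i * d j i)"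
    by auto
  then show ?thesis
  proof cases
    case 1
    then obtain l where l: "\<forall>j<q. 0 \<le> l j" "0 < (\<Sum>j<q. l j)" "\<And>i. (\<Sum>j<q. l j * d j i) \<le> 0"
      unfolding C_def by auto
    define s where "s = (\<Sum>j<q. l j)"
    have s: "0 < s" using l by (simp add: s_def)
    define lam where "lam j = of_nat n * l j / s" for j
    have "(\<Sum>j<q. lam j) = of_nat n"
      using s by (simp add: lam_def sum_divide_distrib[symmetric] sum_distrib_left[symmetric] s_def)
    moreover have "(\<Sum>j<q. of_nat (v j $ i) * lam j) \<le> of_nat (\<alpha> $ i)" for i
    proof -
      have "(\<Sum>j<q. l j * d j i) = (\<Sum>j<q. of_nat n * of_nat (v j $ i) * l j) - s * of_nat (\<alpha> $ i)"
        by (simp add: d_def s_def sum_distrib_right sum_subtractf algebra_simps)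
      then have "(\<Sum>j<q. of_nat n * of_nat (v j $ i) * l j) \<le> s * of_nat (\<alpha> $ i)"
        using l(3)[of i] by simp
      moreover have "(\<Sum>j<q. of_nat (v j $ i) * lam j) = (\<Sum>j<q. of_nat n * of_nat (v j $ i) * l j) / s"
        by (simp add: lam_def sum_divide_distrib algebra_simps)
      ultimately show ?thesis using s by (simp add: pos_divide_le_eq mult.commute)
    qed
    ultimately show ?thesis using l(1) s
      by (intro exI[of _ lam]) (auto simp: less_eq_vec_def rat_vec_def lam_def)
  next
    case 2
    define G where "G = (\<Inter>i. {w :: real ^ 's. 0 < w $ i}) \<inter>
      (\<Inter>j\<in>{..<q}. {w. weight w \<alpha> < real n * weight w (v j)})"
    have "open G" unfolding G_def weight_def
      by (intro open_Int open_INT ballI open_Collect_less continuous_intros) auto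
    moreover have "(\<chi> i. of_rat (w i)) \<in> G"
    proof -
      have "weight (\<chi> i. of_rat (w i)) \<alpha> < real n * weight (\<chi> i. of_rat (w i)) (v j)" if "j < q" for j
      proof -
        have "(0::real) < of_rat (\<Sum>i\<in>UNIV. w i * d j i)" using 2(2)[OF that] by simp
        also have "\<dots> = real n * weight (\<chi> i. of_rat (w i)) (v j) - weight (\<chi> i. of_rat (w i)) \<alpha>"
          by (simp add: weight_def d_def of_rat_sum of_rat_mult of_rat_diff sum_distrib_left
              sum_subtractf algebra_simps)
        finally show ?thesis by simp
      qed
      then show ?thesis using 2(1) by (auto simp: G_def)
    qed
    ultimately obtain u where u: "u \<in> G" "inj (weight u)" using generic_weight by blast
    have gen: "weight u \<alpha> < real n * weight u (v j)" if "j < q" for j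
      using u(1) that by (auto simp: G_def)
    have u_nonneg: "0 \<le> u $ i" for i
      using u(1) by (auto simp: G_def intro: less_imp_le)
    have heavy: "real i * weight u \<alpha> < weight u x" if x: "x \<in> power_exponents q v (n * i)" "i \<ge> 1" for x i
    proof -
      obtain m where m: "(\<Sum>j<q. m j) = n * i" "mat_vec_mult q (incidence_matrix v) m \<le> x"
        using x by (auto simp: power_exponents_def)
      have "0 < (\<Sum>j<q. m j)" using m n x by simp
      then obtain j where j: "j < q" "0 < m j"
        by (metis lessThan_iff less_numeral_extra(3) neq0_conv sum.neutral)
      have "real n * (real i * weight u \<alpha>) = real (\<Sum>j<q. m j) * weight u \<alpha>" by (simp add: m)
      also have "\<dots> = (\<Sum>j<q. real (m j) * weight u \<alpha>)" by (simp add: sum_distrib_right)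
      also have "\<dots> < (\<Sum>j<q. real (m j) * (real n * weight u (v j)))"
      proof (rule sum_strict_mono_ex1)
        show "\<forall>j\<in>{..<q}. real (m j) * weight u \<alpha> \<le> real (m j) * (real n * weight u (v j))"
          using gen by (auto intro!: mult_left_mono intro: less_imp_le)
        have "real (m j) * weight u \<alpha> < real (m j) * (real n * weight u (v j))"
          using gen[OF j(1)] j(2) by (intro mult_strict_left_mono) auto
        then show "\<exists>j\<in>{..<q}. real (m j) * weight u \<alpha> < real (m j) * (real n * weight u (v j))"
          using j(1) by blast
      qed simp
      also have "\<dots> = real n * weight u (mat_vec_mult q (incidence_matrix v) m)"
        by (simp add: weight_mat_vec_mult sum_distrib_left algebra_simps)
      also have "\<dots> \<le> real n * weight u x"
        using m u_nonneg by (intro mult_left_mono weight_mono) auto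
      finally show ?thesis using n by simp
    qed
    obtain b where b: "b \<in> Poly_Mapping.keys f" "\<And>x. x \<in> Poly_Mapping.keys f \<Longrightarrow> weight u b \<le> weight u x"
      using \<alpha> finite_keys[of f] by (metis arg_min_if_finite(1,2) empty_iff linorder_not_less)
    obtain N c where N: "N \<ge> 1"
      and c: "\<And>i. i \<in> {1..N} \<Longrightarrow> c i \<in> supported_on (power_exponents q v (n * i))"
      and eq: "f ^ N + (\<Sum>i=1..N. c i * f ^ (N - i)) = 0"
      using int unfolding integral_over_ideal_def ideal_power_power_exponents by blast
    note least = power_least_weight[of "weight u" b f, OF weight_add u(2) b]
    obtain y where y: "y \<in> Poly_Mapping.keys (f ^ N)" "weight u y = real N * weight u b"
      using least by blast
    have "Poly_Mapping.lookup (f ^ N) y + Poly_Mapping.lookup (\<Sum>i=1..N. c i * f ^ (N - i)) y = 0"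
      using eq by (metis lookup_add lookup_zero)
    then have "y \<in> Poly_Mapping.keys (\<Sum>i=1..N. c i * f ^ (N - i))"
      using y(1) by (auto simp: in_keys_iff)
    then obtain i where i: "i \<in> {1..N}" "y \<in> Poly_Mapping.keys (c i * f ^ (N - i))"
      using keys_sum[of "\<lambda>i. c i * f ^ (N - i)" "{1..N}"] by blast
    then obtain x z where xz: "y = x + z" "x \<in> Poly_Mapping.keys (c i)" "z \<in> Poly_Mapping.keys (f ^ (N - i))"
      using keys_mult[of "c i" "f ^ (N - i)"] by blast
    have "real i * weight u b \<le> real i * weight u \<alpha>" using b(2)[OF \<alpha>] by (intro mult_left_mono) auto
    also have "\<dots> < weight u x"
      using c[OF i(1)] xz(2) i(1) by (intro heavy) (auto simp: supported_on_def)
    finally have "real i * weight u b < weight u x" .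
    moreover have "real (N - i) * weight u b \<le> weight u z" using least xz(3) by blast
    ultimately have "(real i + real (N - i)) * weight u b < weight u y"
      unfolding xz(1) weight_add distrib_right by (rule add_less_le_mono)
    moreover have "real i + real (N - i) = real N" using i(1) by simp
    ultimately have "real N * weight u b < weight u y" by (simp only:)
    then show ?thesis using y(2) by simp
  qed
qed

lemma common_denominator:
  fixes x :: "nat \<Rightarrow> rat"
  assumes "\<forall>j<q. 0 \<le> x j"
  shows "\<exists>p\<ge>1. \<forall>j<q. \<exists>r. of_nat p * x j = of_nat r"
  using assms
proof (induction q)
  case (Suc q)
  then obtain p where p: "p \<ge> 1" "\<forall>j<q. \<exists>r. of_nat p * x j = of_nat r" by auto
  obtain a b where ab: "x q = of_int a / of_int b" "0 < b"
    by (metis Rat_cases Fract_of_int_quotient)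
  then have "0 \<le> a" using Suc.prems by (auto simp: zero_le_divide_iff)
  have bx: "of_nat (nat b) * x q = of_nat (nat a)"
    using ab \<open>0 \<le> a\<close> by (simp add: of_nat_nat)
  have "\<exists>r. of_nat (p * nat b) * x j = of_nat r" if j: "j < Suc q" for j
  proof (cases "j = q")
    case True
    have "of_nat (p * nat b) * x q = of_nat p * (of_nat (nat b) * x q)"
      by (simp only: of_nat_mult mult.assoc)
    also have "\<dots> = of_nat (p * nat a)" unfolding bx by simp
    finally show ?thesis using True by blast
  next
    case False
    then obtain r where r: "of_nat p * x j = of_nat r" using p j by (auto simp: less_Suc_eq)
    have "of_nat (p * nat b) * x j = of_nat (nat b) * (of_nat p * x j)"
      by (simp only: of_nat_mult ac_simps)
    also have "\<dots> = of_nat (nat b * r)" unfolding r by simp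
    finally show ?thesis by blast
  qed
  moreover have "1 \<le> p * nat b" using p(1) ab(2) by simp
  ultimately show ?case by blast
qed auto

text \<open>
  If \<open>p \<lambda>\<close> is integral, it shows that \<open>p \<alpha>\<close> is an exponent of \<open>I\<^sup>n\<^sup>p = (I\<^sup>n)\<^sup>p\<close>.
\<close>

lemma polyhedron_exponent_integral:
  fixes lam :: "nat \<Rightarrow> rat"
  assumes nn: "\<forall>j<q. 0 \<le> lam j" and sum: "(\<Sum>j<q. lam j) = of_nat n"
    and le: "mat_vec_mult q (incidence_matrix v) lam \<le> rat_vec \<alpha>"
  shows "integral_over_ideal (tmonom \<alpha> :: ('s::finite, 'k::field) mpoly_ring)
    (supported_on (power_exponents q v n))"
proof -
  obtain p r where p: "p \<ge> 1" and r: "\<And>j. j < q \<Longrightarrow> of_nat p * lam j = of_nat (r j)"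
    using common_denominator[OF nn] by metis
  have "(of_nat (\<Sum>j<q. r j) :: rat) = (\<Sum>j<q. of_nat p * lam j)" by (simp add: r)
  also have "\<dots> = of_nat (n * p)" by (simp add: sum_distrib_left[symmetric] sum)
  finally have sum_r: "(\<Sum>j<q. r j) = n * p" by (simp only: of_nat_eq_iff)
  have "(\<Sum>j<q. v j $ i * r j) \<le> p * \<alpha> $ i" for i
  proof -
    have "(of_nat (\<Sum>j<q. v j $ i * r j) :: rat) = (\<Sum>j<q. of_nat (v j $ i) * (of_nat p * lam j))"
      by (simp add: r)
    also have "\<dots> = of_nat p * (\<Sum>j<q. of_nat (v j $ i) * lam j)"
      by (simp add: sum_distrib_left algebra_simps)
    also have "\<dots> \<le> of_nat p * of_nat (\<alpha> $ i)"
      using le by (intro mult_left_mono) (auto simp: less_eq_vec_def rat_vec_def)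
    also have "\<dots> = of_nat (p * \<alpha> $ i)" by simp
    finally show ?thesis by (simp only: of_nat_le_iff)
  qed
  then have "(\<chi> i. p * \<alpha> $ i) \<in> power_exponents q v (n * p)"
    unfolding power_exponents_def using sum_r by (auto simp: less_eq_vec_def)
  then have "tmonom \<alpha> ^ p \<in> (supported_on (power_exponents q v (n * p)) :: ('s, 'k) mpoly_ring set)"
    unfolding power_tmonom by (simp add: supported_on_def tmonom_eq_single)
  then show ?thesis
    using p subspace_power_exponents
    by (intro integral_over_ideal_if_power[of p]) (auto simp: ideal_power_power_exponents)
qed

section \<open>Normality and rounding of rational vectors\<close>

theorem proposition3p2:
  fixes I :: "('s::finite, 'k::field) mpoly_ring set"
    and q :: nat
    and v :: "nat \<Rightarrow> nat ^ 's"
    and A :: "'s \<Rightarrow> nat \<Rightarrow> nat"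
  assumes "monomial_ideal I"
    and "inj_on v {..<q}"
    and "minimal_monomial_generators ((\<lambda>j. tmonom (v j)) ` {..<q}) I"
    and "A = incidence_matrix v"
  shows "normal_ideal I \<longleftrightarrow>
    (\<forall>(\<alpha> :: nat ^ 's) (lam :: nat \<Rightarrow> rat).
       (\<forall>j<q. 0 \<le> lam j) \<and> mat_vec_mult q A lam \<le> rat_vec \<alpha> \<longrightarrow>
       (\<exists>(m :: nat \<Rightarrow> nat) (\<epsilon> :: rat).
          mat_vec_mult q A m \<le> \<alpha> \<and>
          (\<Sum>j<q. lam j) = of_nat (\<Sum>j<q. m j) + \<epsilon> \<and> 0 \<le> \<epsilon> \<and> \<epsilon> < 1))"
    (is "_ \<longleftrightarrow> (\<forall>\<alpha> lam. ?hyp \<alpha> lam \<longrightarrow> ?rounded \<alpha> lam)")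
proof
  have I: "I = ideal.span ((\<lambda>j. tmonom (v j)) ` {..<q})"
    using assms(3) by (simp add: minimal_monomial_generators_def)
  have I_power: "ideal_power I n = supported_on (power_exponents q v n)" for n
    unfolding I by (rule ideal_power_span_monomials)
  {
    assume normal: "normal_ideal I"
    show "\<forall>\<alpha> lam. ?hyp \<alpha> lam \<longrightarrow> ?rounded \<alpha> lam"
    proof (intro allI impI)
      fix \<alpha> and lam :: "nat \<Rightarrow> rat" assume hyp: "?hyp \<alpha> lam"
      define s where "s = (\<Sum>j<q. lam j)"
      define n where "n = nat \<lfloor>s\<rfloor>"
      have s: "0 \<le> s" unfolding s_def using hyp by (intro sum_nonneg) auto
      then have n: "of_nat n \<le> s" "s < of_nat n + 1" unfolding n_def by (simp_all, linarith+)
      have "\<alpha> \<in> power_exponents q v n"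
      proof (cases "n = 0")
        case True
        then show ?thesis by (simp add: power_exponents_0)
      next
        case False
        then have "0 < s" using n by linarith
        \<comment> \<open>Shrink \<open>lam\<close> so that its entries add up to \<open>n\<close>, the integer part of \<open>s\<close>.\<close>
        define mu where "mu j = of_nat n / s * lam j" for j
        have "of_nat n / s \<le> 1" using n \<open>0 < s\<close> by simp
        have mu: "0 \<le> mu j" "mu j \<le> lam j" if "j < q" for j
        proof -
          have "0 \<le> lam j" using hyp that by blast
          moreover have "0 \<le> of_nat n / s" using \<open>0 < s\<close> by simp
          ultimately show "0 \<le> mu j" "mu j \<le> lam j" unfolding mu_def
            by (rule mult_nonneg_nonneg[rotated], rule mult_left_le_one_le[OF _ _ \<open>of_nat n / s \<le> 1\<close>])
        qed
        have "(\<Sum>j<q. mu j) = of_nat n"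
        proof -
          have "(\<Sum>j<q. mu j) = of_nat n / s * s"
            by (simp only: mu_def s_def sum_distrib_left)
          then show ?thesis using \<open>0 < s\<close> by simp
        qed
        moreover have "mat_vec_mult q (incidence_matrix v) mu \<le> rat_vec \<alpha>"
        proof -
          have "(\<Sum>j<q. of_nat (v j $ i) * mu j) \<le> (\<Sum>j<q. of_nat (v j $ i) * lam j)" for i
            using mu by (intro sum_mono mult_left_mono) auto
          then show ?thesis
            using hyp unfolding assms(4) less_eq_vec_def by (auto intro: order_trans)
        qed
        ultimately have "(tmonom \<alpha> :: ('s, 'k) mpoly_ring) \<in> ideal_integral_closure (ideal_power I n)"
          using polyhedron_exponent_integral[of q mu n v \<alpha>] mu(1)
          by (simp add: ideal_integral_closure_def I_power)
        then have "(tmonom \<alpha> :: ('s, 'k) mpoly_ring) \<in> ideal_power I n"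
          using normal False by (simp add: normal_ideal_def)
        then show ?thesis by (simp add: I_power supported_on_def tmonom_eq_single)
      qed
      then obtain m where "(\<Sum>j<q. m j) = n" "mat_vec_mult q (incidence_matrix v) m \<le> \<alpha>"
        by (auto simp: power_exponents_def)
      then show "?rounded \<alpha> lam"
        using n unfolding assms(4) s_def[symmetric]
        by (intro exI[of _ m] exI[of _ "s - of_nat n"]) auto
    qed
  next
    assume round: "\<forall>\<alpha> lam. ?hyp \<alpha> lam \<longrightarrow> ?rounded \<alpha> lam"
    have "ideal_power I n = ideal_integral_closure (ideal_power I n)" if n: "n \<ge> 1" for n
    proof
      show "ideal_power I n \<subseteq> ideal_integral_closure (ideal_power I n)"
        unfolding I_power ideal_integral_closure_def
        using integral_over_self[OF subspace_power_exponents] by blast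
      show "ideal_integral_closure (ideal_power I n) \<subseteq> ideal_power I n"
      proof
        fix f assume "f \<in> ideal_integral_closure (ideal_power I n)"
        then have f: "integral_over_ideal f (supported_on (power_exponents q v n))"
          by (simp add: ideal_integral_closure_def I_power)
        have "\<alpha> \<in> power_exponents q v n" if \<alpha>: "\<alpha> \<in> Poly_Mapping.keys f" for \<alpha>
        proof -
          obtain lam where "?hyp \<alpha> lam" and sum: "(\<Sum>j<q. lam j) = of_nat n"
            using integral_exponent_in_polyhedron[OF f \<alpha> n] assms(4) by blast
          then obtain m \<epsilon> where m: "mat_vec_mult q A m \<le> \<alpha>"
            "(of_nat n :: rat) = of_nat (\<Sum>j<q. m j) + \<epsilon>" "0 \<le> \<epsilon>" "\<epsilon> < 1"
            using round by metis
          \<comment> \<open>An integer leaves no room for a fractional part, hence \<open>\<epsilon> = 0\<close>.\<close>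
          have "of_nat (\<Sum>j<q. m j) \<le> (of_nat n :: rat)" "(of_nat n :: rat) < of_nat (Suc (\<Sum>j<q. m j))"
            using m by simp_all
          then have "(\<Sum>j<q. m j) = n" unfolding of_nat_le_iff of_nat_less_iff by simp
          then show ?thesis using m(1) unfolding power_exponents_def assms(4) by blast
        qed
        then show "f \<in> ideal_power I n" by (auto simp: I_power supported_on_def)
      qed
    qed
    moreover have "ideal.subspace I" unfolding I by simp
    ultimately show "normal_ideal I" by (simp add: normal_ideal_def)
  }
qed

end
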